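(* Let $n\ge1$, $O=\{0,1,\dots,n-1\}$ with its usual order, and let $\mathfrak r$ be the rank function of the finite distributive lattice $\mathscr E_O$. Then for every nonempty interval $[\ell..r]\subseteq O$, \[\mathfrak r(\{[\ell..r]\})=(1+\ell)(n-r).\] Moreover, if $k>0$ and $X=\{[\ell_0..r_0],\dots,[\ell_k..r_k]\}\in\mathscr E_O$ with $\ell_0<\ell_1<\cdots<\ell_k$, then \[\mathfrak r(X)=(1+\ell_0)(n-r_0)+\sum_{i=1}^k(\ell_i-\ell_{i-1})(n-r_i).\]
   Context: An interval of $O$ is a set of consecutive elements $[\ell..r]=\{x:\ell\le x\le r\}$ (or $\emptyset$). $\mathscr E_O$ is the set of antichains with respect to inclusion of intervals of $O$, ordered by $A\le B$ iff for every $I\in A$ there is $J\in B$ with $J\subseteq I$; it is a finite distributive lattice with bottom $\emptyset$. The rank function $\mathfrak r:\mathscr E_O\to\mathbf N$ is the function with $\mathfrak r(0)=0$ and $\mathfrak r(x)=\mathfrak r(y)+1$ whenever $x$ covers $y$. *)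

theory Defs
  imports "HOL-Algebra.Lattice"
begin

definition intervals :: "'a::linorder set \<Rightarrow> 'a set set" where
  "intervals S = insert {} {{x \<in> S. l \<le> x \<and> x \<le> r} | l r. l \<in> S \<and> r \<in> S}"

text \<open>Since \<^term>\<open>{}\<close> is itself an interval, \<^term>\<open>{}\<close> (no intervals) and \<^term>\<open>{{}}\<close>
  are two different antichains: the bottom and the top element of the lattice.\<close>

definition interval_antichains :: "'a::linorder set \<Rightarrow> 'a set set gorder" where
  "interval_antichains S =
     \<lparr>carrier = {A. A \<subseteq> intervals S \<and> pairwise (\<lambda>I J. \<not> I \<subseteq> J) A},
      eq = (=),
      le = (\<lambda>A B. \<forall>I\<in>A. \<exists>J\<in>B. J \<subseteq> I)\<rparr>"

definition covers :: "('a, 'b) gorder_scheme \<Rightarrow> 'a \<Rightarrow> 'a \<Rightarrow> bool" where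
  "covers L x y \<longleftrightarrow>
     x \<in> carrier L \<and> y \<in> carrier L \<and> y \<sqsubset>\<^bsub>L\<^esub> x \<and>
     \<not> (\<exists>z\<in>carrier L. y \<sqsubset>\<^bsub>L\<^esub> z \<and> z \<sqsubset>\<^bsub>L\<^esub> x)"

text \<open>Extensionality pins down the irrelevant values outside the carrier, so that the rank
  function of a finite graded order is the only function with the required properties.\<close>

definition is_rank_function :: "('a, 'b) gorder_scheme \<Rightarrow> ('a \<Rightarrow> nat) \<Rightarrow> bool" where
  "is_rank_function L f \<longleftrightarrow>
     f \<in> extensional (carrier L) \<and> f \<bottom>\<^bsub>L\<^esub> = 0 \<and> (\<forall>x y. covers L x y \<longrightarrow> f x = f y + 1)"

definition rank_function :: "('a, 'b) gorder_scheme \<Rightarrow> 'a \<Rightarrow> nat" where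
  "rank_function L = (THE f. is_rank_function L f)"

lemma partial_order_interval_antichains: "partial_order (interval_antichains S)"
proof
  show "(.=\<^bsub>interval_antichains S\<^esub>) = (=)"
    by (simp add: interval_antichains_def)
next
  fix A B
  assume AB: "A \<sqsubseteq>\<^bsub>interval_antichains S\<^esub> B" "B \<sqsubseteq>\<^bsub>interval_antichains S\<^esub> A"
    and mem: "A \<in> carrier (interval_antichains S)" "B \<in> carrier (interval_antichains S)"
  have "X \<subseteq> Y"
    if X: "pairwise (\<lambda>I J. \<not> I \<subseteq> J) X" and XY: "\<forall>I\<in>X. \<exists>J\<in>Y. J \<subseteq> I"
      and YX: "\<forall>I\<in>Y. \<exists>J\<in>X. J \<subseteq> I" for X Y :: "'a set set"
  proof
    fix I assume I: "I \<in> X"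
    with XY obtain J where J: "J \<in> Y" "J \<subseteq> I" by blast
    with YX obtain K where K: "K \<in> X" "K \<subseteq> J" by blast
    with X I J have "K = I" unfolding pairwise_def by (meson subset_trans)
    with J K show "I \<in> Y" by auto
  qed
  with AB mem have "A = B"
    unfolding interval_antichains_def by (simp add: subset_antisym)
  then show "A .=\<^bsub>interval_antichains S\<^esub> B"
    by (simp add: interval_antichains_def)
next
  fix A B C
  assume "A \<sqsubseteq>\<^bsub>interval_antichains S\<^esub> B" "B \<sqsubseteq>\<^bsub>interval_antichains S\<^esub> C"
  then show "A \<sqsubseteq>\<^bsub>interval_antichains S\<^esub> C"
    by (simp add: interval_antichains_def) (meson subset_trans)
qed (auto simp: interval_antichains_def)

lemma bottom_interval_antichains: "\<bottom>\<^bsub>interval_antichains S\<^esub> = {}"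
proof -
  have "least (interval_antichains S) A (carrier (interval_antichains S)) \<longleftrightarrow> A = {}" for A
    by (auto simp: least_def Lower_def interval_antichains_def pairwise_def)
  then show ?thesis
    by (simp add: bottom_def)
qed

end

theory Submission
  imports Defs
begin

text \<open>An antichain \<open>A\<close> is determined by the set of all intervals that contain a member of \<open>A\<close>, and
  this turns the order of \<open>\<E>\<^sub>O\<close> into inclusion of up-closed families. Going up one step adds
  exactly one interval to the family, so the rank of \<open>A\<close> is the cardinality of the family. For
  \<open>A = {[\<ell>\<^sub>0..r\<^sub>0], \<dots>, [\<ell>\<^sub>k..r\<^sub>k]}\<close> the right ends increase as well, and an interval with left end
  \<open>a \<in> (\<ell>\<^bsub>i-1\<^esub>..\<ell>\<^sub>i]\<close> contains a member of \<open>A\<close> iff its right end is at least \<open>r\<^sub>i\<close>.\<close>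

section \<open>Up-closed families and their minimal members\<close>

definition up_closure :: "'a set set \<Rightarrow> 'a set set \<Rightarrow> 'a set set" where
  "up_closure F A = {I \<in> F. \<exists>J\<in>A. J \<subseteq> I}"

definition minimal_members :: "'a set set \<Rightarrow> 'a set set" where
  "minimal_members U = {I \<in> U. \<forall>J\<in>U. J \<subseteq> I \<longrightarrow> J = I}"

lemma minimal_members_subset: "minimal_members U \<subseteq> U"
  by (auto simp: minimal_members_def)

lemma pairwise_minimal_members: "pairwise (\<lambda>I J. \<not> I \<subseteq> J) (minimal_members U)"
  by (auto simp: minimal_members_def pairwise_def)

lemma up_closure_upward:
  "I \<in> up_closure F A \<Longrightarrow> J \<in> F \<Longrightarrow> I \<subseteq> J \<Longrightarrow> J \<in> up_closure F A"
  unfolding up_closure_def by (auto; meson subset_trans)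

text \<open>In a finite family every member lies above a minimal one. Hence every finite up-closed
  family is generated by an antichain, so new antichains can be built by editing families.\<close>

lemma up_closure_minimal_members:
  assumes "finite U" "U \<subseteq> F" "\<And>I J. I \<in> U \<Longrightarrow> J \<in> F \<Longrightarrow> I \<subseteq> J \<Longrightarrow> J \<in> U"
  shows "up_closure F (minimal_members U) = U"
proof
  show "up_closure F (minimal_members U) \<subseteq> U"
    using assms(3) by (auto simp: up_closure_def minimal_members_def)
  show "U \<subseteq> up_closure F (minimal_members U)"
  proof
    fix I assume I: "I \<in> U"
    then obtain J where "J \<in> U" "J \<subseteq> I" "\<forall>K\<in>U. K \<subseteq> J \<longrightarrow> J = K"
      using finite_has_minimal2[OF assms(1)] by blast
    then show "I \<in> up_closure F (minimal_members U)"
      using I assms(2) unfolding up_closure_def minimal_members_def by blast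
  qed
qed

text \<open>Each member of \<open>A\<close> lies in its own up-closure, and containment is
  transitive. The right-hand side is the lattice order.\<close>

lemma up_closure_mono_iff:
  assumes "A \<subseteq> F"
  shows "up_closure F A \<subseteq> up_closure F B \<longleftrightarrow> (\<forall>I\<in>A. \<exists>J\<in>B. J \<subseteq> I)"
proof
  assume "up_closure F A \<subseteq> up_closure F B"
  moreover have "A \<subseteq> up_closure F A"
    using assms by (auto simp: up_closure_def)
  ultimately show "\<forall>I\<in>A. \<exists>J\<in>B. J \<subseteq> I"
    by (auto simp: up_closure_def)
next
  assume "\<forall>I\<in>A. \<exists>J\<in>B. J \<subseteq> I"
  then show "up_closure F A \<subseteq> up_closure F B"
    unfolding up_closure_def by (auto; meson subset_trans)
qed

section \<open>The lattice order as inclusion of families\<close>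

lemma finite_intervals:
  assumes "finite S"
  shows "finite (intervals S)"
proof (rule finite_subset)
  show "intervals S \<subseteq> Pow S"
    by (auto simp: intervals_def)
qed (use assms in simp)

lemma finite_up_closure_intervals:
  "finite S \<Longrightarrow> finite (up_closure (intervals S) A)"
  by (simp add: up_closure_def finite_intervals)

lemma mem_carrier_iff:
  "A \<in> carrier (interval_antichains S) \<longleftrightarrow>
     A \<subseteq> intervals S \<and> pairwise (\<lambda>I J. \<not> I \<subseteq> J) A"
  by (simp add: interval_antichains_def)

lemma le_iff_up_closure:
  assumes "A \<in> carrier (interval_antichains S)"
  shows "A \<sqsubseteq>\<^bsub>interval_antichains S\<^esub> B \<longleftrightarrow>
    up_closure (intervals S) A \<subseteq> up_closure (intervals S) B"
  using assms up_closure_mono_iff[of A "intervals S" B]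
  by (simp add: interval_antichains_def)

lemma up_closure_inj:
  assumes "A \<in> carrier (interval_antichains S)" "B \<in> carrier (interval_antichains S)"
    and "up_closure (intervals S) A = up_closure (intervals S) B"
  shows "A = B"
  using assms le_iff_up_closure[OF assms(1), of B] le_iff_up_closure[OF assms(2), of A]
  by (intro partial_order.le_antisym[OF partial_order_interval_antichains]) simp_all

lemma lless_iff_up_closure:
  assumes "A \<in> carrier (interval_antichains S)" "B \<in> carrier (interval_antichains S)"
  shows "A \<sqsubset>\<^bsub>interval_antichains S\<^esub> B \<longleftrightarrow>
    up_closure (intervals S) A \<subset> up_closure (intervals S) B"
proof -
  have "A .\<noteq>\<^bsub>interval_antichains S\<^esub> B \<longleftrightarrow> A \<noteq> B"
    by (simp add: interval_antichains_def)
  then show ?thesis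
    using assms up_closure_inj[OF assms] by (auto simp: lless_def le_iff_up_closure)
qed

lemma minimal_members_in_carrier:
  "U \<subseteq> intervals S \<Longrightarrow> minimal_members U \<in> carrier (interval_antichains S)"
  using minimal_members_subset[of U] pairwise_minimal_members[of U]
  by (auto simp: mem_carrier_iff)

section \<open>Covers and the rank function\<close>

text \<open>One interval can always be added to the family of \<open>B\<close> inside that of
  \<open>A\<close> without losing up-closedness. The antichain so obtained lies strictly above
  \<open>B\<close>, so the covering leaves no room for it below \<open>A\<close>.\<close>

lemma covers_imp_card_up_closure:
  assumes S: "finite S" and cov: "covers (interval_antichains S) A B"
  shows "card (up_closure (intervals S) A) = card (up_closure (intervals S) B) + 1"
proof -
  let ?L = "interval_antichains S" and ?u = "up_closure (intervals S)"
  have A: "A \<in> carrier ?L" and B: "B \<in> carrier ?L" and less: "B \<sqsubset>\<^bsub>?L\<^esub> A"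
    and nobetween: "\<And>C. C \<in> carrier ?L \<Longrightarrow> \<not> (B \<sqsubset>\<^bsub>?L\<^esub> C \<and> C \<sqsubset>\<^bsub>?L\<^esub> A)"
    using cov by (auto simp: covers_def)
  have sub: "?u B \<subset> ?u A"
    using less A B by (simp add: lless_iff_up_closure)
  have fin: "finite (?u A - ?u B)"
    using S by (simp add: finite_up_closure_intervals)
  \<comment> \<open>Maximality puts every interval strictly larger than \<open>I\<close> into
    \<open>?u B\<close> already, so inserting \<open>I\<close> keeps the family up-closed.\<close>
  obtain I where I: "I \<in> ?u A - ?u B" and max: "\<forall>J\<in>?u A - ?u B. I \<subseteq> J \<longrightarrow> I = J"
    using finite_has_maximal[OF fin] sub by blast
  let ?U = "insert I (?u B)"
  have IF: "?U \<subseteq> intervals S"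
    using I by (auto simp: up_closure_def)
  have "J \<in> ?U" if "K \<in> ?U" "J \<in> intervals S" "K \<subseteq> J" for J K
  proof (cases "K = I")
    case True
    then have "J \<in> ?u A"
      using I that up_closure_upward[of I _ A J] by simp
    then show ?thesis
      using max True that by blast
  next
    case False
    then show ?thesis
      using that up_closure_upward[of K _ B J] by simp
  qed
  moreover have "finite ?U"
    using S by (simp add: finite_up_closure_intervals)
  ultimately have up: "?u (minimal_members ?U) = ?U"
    using IF by (intro up_closure_minimal_members) blast+
  have mem: "minimal_members ?U \<in> carrier ?L"
    using IF by (rule minimal_members_in_carrier)
  have "B \<sqsubset>\<^bsub>?L\<^esub> minimal_members ?U"
    using I B mem by (auto simp: lless_iff_up_closure up)
  then have "\<not> ?U \<subset> ?u A"
    using nobetween[OF mem] A mem by (simp add: lless_iff_up_closure up)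
  then have "?u A = ?U"
    using I sub by auto
  then show ?thesis
    using I S by (simp add: finite_up_closure_intervals)
qed

text \<open>A member \<open>I\<close> of \<open>A\<close> is minimal in the family of
  \<open>A\<close>, so deleting it leaves an up-closed family. The two families differ by one
  element, so nothing fits strictly between them.\<close>

lemma exists_covered:
  assumes S: "finite S" and A: "A \<in> carrier (interval_antichains S)" and "A \<noteq> {}"
  shows "\<exists>B. covers (interval_antichains S) A B"
proof -
  let ?L = "interval_antichains S" and ?u = "up_closure (intervals S)"
  obtain I where I: "I \<in> A"
    using \<open>A \<noteq> {}\<close> by blast
  have AF: "A \<subseteq> intervals S" and anti: "pairwise (\<lambda>I J. \<not> I \<subseteq> J) A"
    using A by (simp_all add: mem_carrier_iff)
  have IA: "I \<in> ?u A"
    using I AF by (auto simp: up_closure_def)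
  let ?U = "?u A - {I}"
  have UF: "?U \<subseteq> intervals S"
    by (auto simp: up_closure_def)
  have "J \<in> ?U" if KU: "K \<in> ?U" and J: "J \<in> intervals S" "K \<subseteq> J" for J K
  proof -
    \<comment> \<open>If \<open>K\<close> were properly inside \<open>I\<close>, the member of
      \<open>A\<close> below \<open>K\<close> would be comparable with \<open>I\<close>, hence equal
      to it, which forces \<open>K = I\<close>.\<close>
    have "J \<noteq> I"
    proof
      assume "J = I"
      obtain M where M: "M \<in> A" "M \<subseteq> K"
        using KU by (auto simp: up_closure_def)
      then have "M \<subseteq> I"
        using J \<open>J = I\<close> by auto
      then have "M = I"
        using pairwiseD[OF anti] M I by blast
      then show False
        using M J KU \<open>J = I\<close> by auto
    qed
    then show ?thesis
      using that up_closure_upward[of K _ A J] by simp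
  qed
  moreover have "finite ?U"
    using S by (simp add: finite_up_closure_intervals)
  ultimately have up: "?u (minimal_members ?U) = ?U"
    using UF by (intro up_closure_minimal_members) blast+
  have mem: "minimal_members ?U \<in> carrier ?L"
    using UF by (rule minimal_members_in_carrier)
  have "covers ?L A (minimal_members ?U)"
    unfolding covers_def
  proof (intro conjI A mem)
    show "minimal_members ?U \<sqsubset>\<^bsub>?L\<^esub> A"
      using IA A mem by (auto simp: lless_iff_up_closure up)
    show "\<not> (\<exists>C\<in>carrier ?L. minimal_members ?U \<sqsubset>\<^bsub>?L\<^esub> C \<and> C \<sqsubset>\<^bsub>?L\<^esub> A)"
      using A mem by (auto simp: lless_iff_up_closure up)
  qed
  then show ?thesis ..
qed

text \<open>By the covering lemma the cardinality is a rank function. It is the only one, because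
  descending along covers from any antichain ends at \<open>{}\<close>; this makes the
  \<open>THE\<close> meaningful.\<close>

lemma rank_function_interval_antichains:
  assumes S: "finite S" and A: "A \<in> carrier (interval_antichains S)"
  shows "rank_function (interval_antichains S) A = card (up_closure (intervals S) A)"
proof -
  let ?L = "interval_antichains S" and ?u = "up_closure (intervals S)"
  \<comment> \<open>Restricting to the carrier meets the extensionality condition of
    \<open>is_rank_function\<close>.\<close>
  let ?f = "restrict (\<lambda>A. card (?u A)) (carrier ?L)"
  have bot: "{} \<in> carrier ?L"
    by (simp add: mem_carrier_iff)
  have "covers ?L x y \<Longrightarrow> ?f x = ?f y + 1" for x y
    using covers_imp_card_up_closure[OF S, of x y] by (simp add: covers_def)
  then have f: "is_rank_function ?L ?f"
    using bot by (simp add: is_rank_function_def bottom_interval_antichains up_closure_def)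
  have "g = ?f" if g: "is_rank_function ?L g" for g
  proof (rule extensionalityI)
    show "g \<in> extensional (carrier ?L)" "?f \<in> extensional (carrier ?L)"
      using g f by (simp_all add: is_rank_function_def)
    fix x assume "x \<in> carrier ?L"
    then show "g x = ?f x"
    proof (induction "card (?u x)" arbitrary: x rule: less_induct)
      case less
      show ?case
      proof (cases "x = {}")
        case True
        then show ?thesis
          using g f by (simp add: is_rank_function_def bottom_interval_antichains)
      next
        case False
        then obtain y where y: "covers ?L x y"
          using exists_covered[OF S less.prems] by blast
        then have "card (?u y) < card (?u x)" "y \<in> carrier ?L"
          using covers_imp_card_up_closure[OF S y] by (auto simp: covers_def)
        then have "g y = ?f y"
          by (rule less.hyps)
        moreover have "g x = g y + 1" "?f x = ?f y + 1"
          using g f y unfolding is_rank_function_def by blast+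
        ultimately show ?thesis
          by simp
      qed
    qed
  qed
  with f have "rank_function ?L = ?f"
    unfolding rank_function_def by (rule the_equality)
  then show ?thesis
    using A by simp
qed

section \<open>Counting the intervals above an antichain\<close>

lemma intervals_lessThan:
  "intervals {..<n::nat} = insert {} {{a..b} | a b. a < n \<and> b < n}"
proof -
  have "{x \<in> {..<n}. a \<le> x \<and> x \<le> b} = {a..b}" if "b < n" for a b
    using that by auto
  then have "{{x \<in> {..<n}. a \<le> x \<and> x \<le> b} | a b. a \<in> {..<n} \<and> b \<in> {..<n}} =
      {{a..b} | a b. a < n \<and> b < n}"
    by (intro Collect_cong ex_cong1) auto
  then show ?thesis
    unfolding intervals_def by (rule arg_cong)
qed

text \<open>The pairs form a staircase region. Each further index adds a rectangle of new columns,
  those with \<open>a\<close> in \<open>{l k<..l (Suc k)}\<close>, which gives one summand.\<close>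

lemma card_end_points:
  fixes l r :: "nat \<Rightarrow> nat"
  assumes "\<forall>i<k. l i < l (Suc i)" "\<forall>i<k. r i \<le> r (Suc i)"
  shows "card {(a, b). \<exists>i\<le>k. a \<le> l i \<and> r i \<le> b \<and> b < n} =
    (1 + l 0) * (n - r 0) + (\<Sum>i=1..k. (l i - l (i - 1)) * (n - r i))"
  using assms
proof (induction k)
  case 0
  have "{(a, b). \<exists>i\<le>0. a \<le> l i \<and> r i \<le> b \<and> b < n} = {..l 0} \<times> {r 0..<n}"
    by auto
  then show ?case
    by (simp add: card_cartesian_product)
next
  case (Suc k)
  let ?P = "\<lambda>k. {(a, b). \<exists>i\<le>k. a \<le> l i \<and> r i \<le> b \<and> b < n}"
  let ?Q = "{l k<..l (Suc k)} \<times> {r (Suc k)..<n}"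
  have mono: "l i \<le> l k" if "i \<le> k" for i
    using that
  proof (induction rule: inc_induct)
    case (step m)
    then have "l m < l (Suc m)"
      using Suc.prems(1) by simp
    with step.IH show ?case
      by linarith
  qed simp
  have split: "?P (Suc k) = ?P k \<union> ?Q"
  proof (intro equalityI subsetI)
    fix p assume "p \<in> ?P (Suc k)"
    then obtain a b i where p: "p = (a, b)" "i \<le> Suc k" "a \<le> l i" "r i \<le> b" "b < n"
      by auto
    show "p \<in> ?P k \<union> ?Q"
    proof (cases "i \<le> k")
      case True
      then show ?thesis using p by auto
    next
      case False
      then have "i = Suc k" using p by simp
      moreover have "r k \<le> r (Suc k)" using Suc.prems by simp
      ultimately show ?thesis using p by (cases "a \<le> l k") auto
    qed
  qed (auto intro: le_SucI)
  \<comment> \<open>This box gives both finiteness and disjointness from \<open>?Q\<close>, whose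
    first coordinates exceed \<open>l k\<close>.\<close>
  have P: "?P k \<subseteq> {..l k} \<times> {..<n}"
    using mono by (auto intro: order_trans)
  then have "finite (?P k)"
    by (rule finite_subset) simp
  moreover have "({..l k} \<times> {..<n}) \<inter> ?Q = {}"
    by auto
  then have "?P k \<inter> ?Q = {}"
    using P by blast
  ultimately have "card (?P (Suc k)) = card (?P k) + card ?Q"
    unfolding split by (intro card_Un_disjoint) simp_all
  then show ?case
    using Suc by (simp add: card_cartesian_product)
qed

text \<open>For nonempty intervals, containing \<open>{l i..r i}\<close> amounts to two inequalities
  between end points, so the family is in bijection with the pairs already counted.\<close>

lemma card_up_closure_chain:
  fixes l r :: "nat \<Rightarrow> nat"
  assumes lr: "\<forall>i\<le>k. l i \<le> r i \<and> r i < n"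
    and l: "\<forall>i<k. l i < l (Suc i)"
    and anti: "pairwise (\<lambda>I J. \<not> I \<subseteq> J) {{l i..r i} | i. i \<le> k}"
  shows "card (up_closure (intervals {..<n}) {{l i..r i} | i. i \<le> k}) =
    (1 + l 0) * (n - r 0) + (\<Sum>i=1..k. (l i - l (i - 1)) * (n - r i))"
proof -
  let ?P = "{(a, b). \<exists>i\<le>k. a \<le> l i \<and> r i \<le> b \<and> b < n}"
  let ?X = "{{l i..r i} | i. i \<le> k}"
  \<comment> \<open>If the right end dropped while the left end grew, the later interval would lie
    properly inside the earlier one.\<close>
  have r: "r i \<le> r (Suc i)" if "i < k" for i
  proof (rule ccontr)
    assume "\<not> r i \<le> r (Suc i)"
    moreover have "l i < l (Suc i)" "l (Suc i) \<le> r (Suc i)"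
      using l lr that by auto
    ultimately have "{l (Suc i)..r (Suc i)} \<subseteq> {l i..r i}"
      "{l (Suc i)..r (Suc i)} \<noteq> {l i..r i}"
      by (auto simp: Icc_eq_Icc)
    moreover have "{l (Suc i)..r (Suc i)} \<in> ?X" "{l i..r i} \<in> ?X"
      using that by (auto intro: exI[of _ "Suc i"] exI[of _ i])
    ultimately show False
      using anti unfolding pairwise_def by blast
  qed
  have le: "a \<le> b" if "(a, b) \<in> ?P" for a b
    using that lr by fastforce
  \<comment> \<open>End points can be read off only from nonempty intervals; here
    \<open>a \<le> l i \<le> r i \<le> b\<close> ensures this.\<close>
  have "inj_on (\<lambda>(a, b). {a..b}) ?P"
  proof (rule inj_onI)
    fix p q assume "p \<in> ?P" "q \<in> ?P" and eq: "(\<lambda>(a, b). {a..b}) p = (\<lambda>(a, b). {a..b}) q"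
    then have "fst p \<le> snd p"
      by (intro le) simp
    then show "p = q"
      using eq by (simp add: case_prod_beta Icc_eq_Icc prod_eq_iff)
  qed
  moreover have "up_closure (intervals {..<n}) ?X = (\<lambda>(a, b). {a..b}) ` ?P"
  proof (intro equalityI subsetI)
    fix I assume "I \<in> up_closure (intervals {..<n}) ?X"
    then obtain i where I: "I \<in> intervals {..<n}" and i: "i \<le> k" "{l i..r i} \<subseteq> I"
      by (auto simp: up_closure_def)
    \<comment> \<open>Nonemptiness of \<open>{l i..r i}\<close> rules out \<open>I = {}\<close>, the
      one interval that need not come with end points.\<close>
    have "l i \<le> r i"
      using lr i by simp
    with I i obtain a b where ab: "I = {a..b}" "b < n"
      by (auto simp: intervals_lessThan)
    then have "a \<le> l i" "r i \<le> b"
      using i \<open>l i \<le> r i\<close> by auto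
    then have "(a, b) \<in> ?P"
      using i ab by auto
    then show "I \<in> (\<lambda>(a, b). {a..b}) ` ?P"
      using ab by force
  next
    fix I assume "I \<in> (\<lambda>(a, b). {a..b}) ` ?P"
    then obtain a b where ab: "I = {a..b}" "(a, b) \<in> ?P"
      by auto
    then obtain i where i: "i \<le> k" "a \<le> l i" "r i \<le> b" "b < n"
      by auto
    have "a < n"
      using le[OF ab(2)] i by simp
    then have "I \<in> intervals {..<n}"
      using ab(1) i by (auto simp: intervals_lessThan)
    moreover have "{l i..r i} \<in> ?X" "{l i..r i} \<subseteq> I"
      using i ab(1) by auto
    ultimately show "I \<in> up_closure (intervals {..<n}) ?X"
      unfolding up_closure_def by blast
  qed
  ultimately show ?thesis
    using card_end_points[of k l r n] l r by (simp add: card_image)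
qed

lemma rank_function_chain:
  fixes l r :: "nat \<Rightarrow> nat"
  assumes "\<forall>i\<le>k. l i \<le> r i \<and> r i < n" "\<forall>i<k. l i < l (Suc i)"
    and "{{l i..r i} | i. i \<le> k} \<in> carrier (interval_antichains {..<n})"
  shows "rank_function (interval_antichains {..<n}) {{l i..r i} | i. i \<le> k} =
    (1 + l 0) * (n - r 0) + (\<Sum>i=1..k. (l i - l (i - 1)) * (n - r i))"
proof -
  have "pairwise (\<lambda>I J. \<not> I \<subseteq> J) {{l i..r i} | i. i \<le> k}"
    using assms(3) by (simp only: mem_carrier_iff)
  then show ?thesis
    using rank_function_interval_antichains[OF finite_lessThan assms(3)]
      card_up_closure_chain[OF assms(1,2)] by simp
qed

theorem theorem27:
  fixes n :: nat
  assumes "n \<ge> 1"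
  shows "(\<forall>l r. l \<le> r \<and> r < n \<longrightarrow>
            rank_function (interval_antichains {..<n}) {{l..r}} = (1 + l) * (n - r)) \<and>
         (\<forall>k (l :: nat \<Rightarrow> nat) (r :: nat \<Rightarrow> nat).
            k > 0 \<and>
            (\<forall>i\<le>k. l i \<le> r i \<and> r i < n) \<and>
            (\<forall>i<k. l i < l (Suc i)) \<and>
            {{l i..r i} | i. i \<le> k} \<in> carrier (interval_antichains {..<n}) \<longrightarrow>
            rank_function (interval_antichains {..<n}) {{l i..r i} | i. i \<le> k} =
              (1 + l 0) * (n - r 0) + (\<Sum>i=1..k. (l i - l (i - 1)) * (n - r i)))"
proof (intro conjI allI impI)
  fix l r :: nat
  assume lr: "l \<le> r \<and> r < n"
  \<comment> \<open>A single interval is the chain with \<open>k = 0\<close> and constant end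
    points; the sum is then empty.\<close>
  have "{{l..r} | i. i \<le> (0::nat)} = {{l..r}}"
    by auto
  moreover have "{{l..r}} \<in> carrier (interval_antichains {..<n})"
    using lr by (auto simp: mem_carrier_iff intervals_lessThan)
  ultimately show "rank_function (interval_antichains {..<n}) {{l..r}} = (1 + l) * (n - r)"
    using rank_function_chain[of 0 "\<lambda>_. l" "\<lambda>_. r" n] lr by simp
qed (rule rank_function_chain; blast)

end
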